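(* Assume the standing assumptions on $F$. Consider SVRC under sampling without replacement, fix an iteration $k$ with $k\bmod m\ne0$, and condition on all randomness up to the computation of $x_k$ (so $x_k$, $\tilde x$, $s_k$ are fixed). Let $\zeta\in(0,1)$. If $$|\xi_g(k)|\ge\Big(\frac1N+\frac{\beta^2\max\{\|s_k\|^4,\epsilon_1^4\}}{64L_1^2\|x_k-\tilde x\|^2\log(2(d+1)/\zeta)}\Big)^{-1},$$ then with probability at least $1-\zeta$, $\|g_k-\nabla F(x_k)\|\le\beta\max\{\|s_k\|^2,\epsilon_1^2\}$. If $$|\xi_H(k)|\ge\Big(\frac1N+\frac{\alpha^2\max\{\|s_k\|^2,\epsilon_1^2\}}{64L_2^2\|x_k-\tilde x\|^2\log(4d/\zeta)}\Big)^{-1},$$ then with probability at least $1-\zeta$, $\|H_k-\nabla^2F(x_k)\|\le\alpha\max\{\|s_k\|,\epsilon_1\}$.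
   Context: Objective: $F(x)=\frac1N\sum_{i=1}^N f_i(x)$ on $\mathbb{R}^d$, each $f_i$ twice differentiable. Standing assumptions: $F^*\triangleq\inf_x F(x)>-\infty$; for every $i$, $f_i$, $\nabla f_i$ and $\nabla^2 f_i$ are Lipschitz with constants $L_0$, $L_1$, $L_2$ respectively (Hessian differences measured in spectral norm). All matrix norms are spectral norms. SVRC iteration with parameters $x_0\in\mathbb{R}^d$, $\epsilon_1>0$, integer $m\ge1$, $M>0$: for $k=0,1,2,\dots$: if $k\bmod m=0$, set $g_k=\nabla F(x_k)$, $H_k=\nabla^2F(x_k)$ and set the reference quantities $\tilde x=x_k$, $\tilde g=g_k$, $\tilde H=H_k$; otherwise draw index collections $\xi_g(k),\xi_H(k)\subseteq\{1,\dots,N\}$ at random and set $g_k=\frac1{|\xi_g(k)|}\sum_{i\in\xi_g(k)}(\nabla f_i(x_k)-\nabla f_i(\tilde x))+\tilde g$, $H_k=\frac1{|\xi_H(k)|}\sum_{i\in\xi_H(k)}(\nabla^2 f_i(x_k)-\nabla^2 f_i(\tilde x))+\tilde H$. Then $s_{k+1}$ is a global minimizer of $s\mapsto g_k^\top s+\frac12 s^\top H_k s+\frac M6\|s\|^3$, $x_{k+1}=x_k+s_{k+1}$, and the algorithm stops and returns $x_{k+1}$ if $\max\{\|s_{k+1}\|,\|s_k\|\}\le\epsilon_1$. By convention $s_0$ is a vector with $\|s_0\|=\epsilon_1$. Sampling without replacement: $\xi_g(k)$ and $\xi_H(k)$ are drawn uniformly at random among all subsets of $\{1,\dots,N\}$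 of the prescribed cardinalities (cardinalities less than $N$). Here $\alpha,\beta>0$ are fixed constants. *)

theory Defs
  imports "HOL-Analysis.Analysis" "HOL-Probability.Probability"
begin

definition spec_norm :: "real^'n^'n \<Rightarrow> real" where
  "spec_norm A = onorm (\<lambda>v. A *v v)"

definition avg_vec :: "nat \<Rightarrow> (nat \<Rightarrow> 'a \<Rightarrow> 'b::real_vector) \<Rightarrow> 'a \<Rightarrow> 'b" where
  "avg_vec N h x = (1 / real N) *\<^sub>R (\<Sum>i<N. h i x)"

text \<open>Subsampled variance-reduced estimator:
  (1/|S|) sum_{i in S} (h_i(x) - h_i(xt)) + ht, with ht the full average at the reference point.\<close>
definition vr_est :: "(nat \<Rightarrow> 'a \<Rightarrow> 'b::real_vector) \<Rightarrow> nat set \<Rightarrow> 'a \<Rightarrow> 'a \<Rightarrow> 'b \<Rightarrow> 'b" where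
  "vr_est h S x xt ht = (1 / real (card S)) *\<^sub>R (\<Sum>i\<in>S. (h i x - h i xt)) + ht"

definition subset_sample :: "nat \<Rightarrow> nat \<Rightarrow> nat set pmf" where
  "subset_sample N b = pmf_of_set {S. S \<subseteq> {0..<N} \<and> card S = b}"

end

theory Submission
  imports Defs
begin

text \<open>Let \<open>X\<close> be the error of the mean of \<open>b\<close> symmetric matrices sampled from \<open>N\<close>. Exchanging
  a sampled index \<open>i\<close> with an unsampled index \<open>j\<close> preserves the distribution of the sample and
  changes \<open>X\<close> by \<open>(a\<^sub>i - a\<^sub>j) / b\<close>, while the sum of \<open>a\<^sub>i - a\<^sub>j\<close> over all such pairs is \<open>b N X\<close>. This
  exchangeable pair, with a mean value inequality for the trace, bounds \<open>E tr X\<^bsup>2n+2\<^esup>\<close> by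
  \<open>(2n+1) V E tr X\<^bsup>2n\<^esup>\<close> where \<open>V\<close> is proportional to \<open>1/b - 1/N\<close>, so that the even moments of \<open>X\<close>,
  hence its tail, are bounded by those of a Gaussian. Hermitian dilation reduces rectangular
  matrices to symmetric ones; it yields the dimension \<open>2d\<close> for Hessians and \<open>d + 1\<close> for
  gradients, viewed as column matrices.\<close>

subsection \<open>Frobenius and operator norms\<close>

lemma linear_transpose: "linear (transpose :: real^'n^'m \<Rightarrow> real^'m^'n)"
  by (rule linearI) (simp_all add: transpose_def vec_eq_iff)

lemma inner_transpose: "transpose A \<bullet> transpose B = A \<bullet> (B :: real^'n^'m)"
  by (simp add: inner_vec_def transpose_def) (rule sum.swap)

lemma norm_transpose: "norm (transpose A) = norm (A :: real^'n^'m)"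
  by (simp add: norm_eq_sqrt_inner inner_transpose)

lemma inner_eq_sum_columns: "A \<bullet> B = (\<Sum>j\<in>UNIV. column j A \<bullet> column j (B :: real^'n^'m))"
proof -
  have "A \<bullet> B = transpose A \<bullet> transpose B"
    by (simp add: inner_transpose)
  then show ?thesis
    by (subst (asm) (2) inner_vec_def) (simp add: column_def transpose_def)
qed

lemma norm_eq_L2_set_columns: "norm A = L2_set (\<lambda>j. norm (column j A)) UNIV"
  for A :: "real^'n^'m"
  by (simp add: norm_eq_sqrt_inner inner_eq_sum_columns[of A] L2_set_def)

lemma column_matrix_mult: "column j (A ** B) = A *v column j B"
  by (simp add: vec_eq_iff column_def matrix_matrix_mult_def matrix_vector_mult_def)

lemma inner_matrix_mult_left: "(A ** B) \<bullet> C = B \<bullet> (transpose A ** C)"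
  for A :: "real^'m^'k" and B :: "real^'n^'m"
proof -
  have "(A *v u) \<bullet> v = u \<bullet> (transpose A *v v)" for u v
    using dot_lmul_matrix[of v A u] by (simp add: inner_commute)
  then show ?thesis
    by (simp only: inner_eq_sum_columns[of "A ** B"] inner_eq_sum_columns[of B]
        column_matrix_mult)
qed

lemma inner_matrix_mult_right: "(A ** B) \<bullet> C = A \<bullet> (C ** transpose B)"
  for A :: "real^'m^'k" and B :: "real^'n^'m"
proof -
  have "(A ** B) \<bullet> C = (transpose B ** transpose A) \<bullet> transpose C"
    by (metis inner_transpose matrix_transpose_mul)
  also have "\<dots> = transpose A \<bullet> (B ** transpose C)"
    by (simp add: inner_matrix_mult_left)
  also have "\<dots> = A \<bullet> (C ** transpose B)"
    by (metis inner_transpose matrix_transpose_mul transpose_transpose)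
  finally show ?thesis .
qed

lemma norm_matrix_vector_mult_le: "norm (A *v v) \<le> norm A * norm v"
  for A :: "real^'n^'m"
proof -
  have "norm (A *v v) = L2_set (\<lambda>i. norm (A $ i \<bullet> v)) UNIV"
    by (simp add: norm_vec_def matrix_vector_mul_component)
  also have "\<dots> \<le> L2_set (\<lambda>i. norm (A $ i) * norm v) UNIV"
    by (intro L2_set_mono) (simp_all add: Cauchy_Schwarz_ineq2)
  also have "\<dots> = norm A * norm v"
    by (simp add: norm_vec_def L2_set_left_distrib)
  finally show ?thesis .
qed

lemma onorm_transpose: "onorm ((*v) (transpose A)) = onorm ((*v) A)"
  for A :: "real^'n^'m"
proof -
  have transpose_le: "onorm ((*v) (transpose A)) \<le> onorm ((*v) A)" for A :: "real^'p^'q"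
  proof (rule onorm_le)
    fix v
    let ?w = "transpose A *v v"
    have "(norm ?w)\<^sup>2 = v \<bullet> (A *v ?w)"
      using dot_lmul_matrix[of v A ?w] by (simp add: power2_norm_eq_inner)
    also have "\<dots> \<le> norm v * norm (A *v ?w)"
      by (rule norm_cauchy_schwarz)
    also have "\<dots> \<le> norm v * (onorm ((*v) A) * norm ?w)"
      by (intro mult_left_mono onorm matrix_vector_mul_bounded_linear) simp
    finally have "norm ?w * norm ?w \<le> (onorm ((*v) A) * norm v) * norm ?w"
      by (simp add: power2_eq_square mult_ac)
    then show "norm ?w \<le> onorm ((*v) A) * norm v"
      by (cases "norm ?w = 0") (simp_all add: onorm_pos_le)
  qed
  show ?thesis
    using transpose_le[of A] transpose_le[of "transpose A"]
    by (simp only: transpose_transpose order_antisym)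
qed

lemma onorm_scaleR_matrix: "onorm ((*v) (r *\<^sub>R A)) = \<bar>r\<bar> * onorm ((*v) A)"
  for A :: "real^'n^'m"
  using onorm_scaleR[OF matrix_vector_mul_bounded_linear, of r A]
  by (simp add: scaleR_matrix_vector_assoc)

lemma onorm_matrix_diff_le: "onorm ((*v) (A - B)) \<le> onorm ((*v) A) + onorm ((*v) B)"
  for A B :: "real^'n^'m"
proof -
  have "(*v) (A - B) = (\<lambda>v. A *v v + - (B *v v))"
    by (simp add: fun_eq_iff matrix_vector_mult_diff_rdistrib)
  then show ?thesis
    using onorm_triangle[of "(*v) A" "\<lambda>v. - (B *v v)"]
    by (simp add: onorm_neg bounded_linear_minus)
qed

lemma norm_matrix_mult_le_onorm_norm: "norm (A ** B) \<le> onorm ((*v) A) * norm B"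
  for A :: "real^'m^'k" and B :: "real^'n^'m"
proof -
  have "norm (A ** B) = L2_set (\<lambda>j. norm (A *v column j B)) UNIV"
    by (simp add: norm_eq_L2_set_columns column_matrix_mult)
  also have "\<dots> \<le> L2_set (\<lambda>j. onorm ((*v) A) * norm (column j B)) UNIV"
    by (intro L2_set_mono onorm matrix_vector_mul_bounded_linear) simp
  also have "\<dots> = onorm ((*v) A) * norm B"
    by (simp add: norm_eq_L2_set_columns[of B] L2_set_right_distrib onorm_pos_le)
  finally show ?thesis .
qed

lemma norm_matrix_mult_le_norm_onorm: "norm (A ** B) \<le> norm A * onorm ((*v) B)"
  for A :: "real^'m^'k" and B :: "real^'n^'m"
  using norm_matrix_mult_le_onorm_norm[of "transpose B" "transpose A"]
  by (simp only: matrix_transpose_mul[symmetric] norm_transpose onorm_transpose mult.commute)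

lemma norm_mat_1_squared: "(norm (mat 1 :: real^'n^'n))\<^sup>2 = real CARD('n)"
proof -
  have "(norm (mat 1 :: real^'n^'n))\<^sup>2 = (\<Sum>i\<in>UNIV. \<Sum>j\<in>UNIV. if i = (j :: 'n) then 1 else 0)"
    unfolding power2_norm_eq_inner inner_vec_def by (intro sum.cong refl) (simp add: mat_def)
  then show ?thesis by simp
qed

lemma onorm_attained:
  fixes f :: "'a::euclidean_space \<Rightarrow> 'b::real_normed_vector"
  assumes "linear f"
  obtains v where "norm v = 1" "norm (f v) = onorm f"
proof -
  have bounded: "bounded_linear f" using assms by (rule linear_linear[THEN iffD2])
  have "continuous_on (sphere 0 1) (\<lambda>v. norm (f v))"
    by (intro continuous_on_norm linear_continuous_on bounded)
  moreover have "sphere (0::'a) 1 \<noteq> {}"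
    by simp
  ultimately obtain v where unit: "norm v = 1"
    and maximal: "\<And>u. norm u = 1 \<Longrightarrow> norm (f u) \<le> norm (f v)"
    using continuous_attains_sup[OF compact_sphere] by (metis mem_sphere_0)
  have "onorm f \<le> norm (f v)"
  proof (rule onorm_le)
    fix u
    show "norm (f u) \<le> norm (f v) * norm u"
    proof (cases "u = 0")
      case False
      then have "norm (f (u /\<^sub>R norm u)) \<le> norm (f v)"
        by (intro maximal) simp
      with False show ?thesis
        by (simp add: linear_cmul[OF assms] divide_simps mult.commute)
    qed (simp add: linear_0[OF assms])
  qed
  moreover have "norm (f v) \<le> onorm f"
    using onorm[OF bounded, of v] unit by simp
  ultimately show ?thesis
    using that unit by simp
qed

subsection \<open>Powers of symmetric matrices\<close>

primrec matrix_power :: "'a::semiring_1^'n^'n \<Rightarrow> nat \<Rightarrow> 'a^'n^'n" where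
  "matrix_power A 0 = mat 1"
| "matrix_power A (Suc k) = A ** matrix_power A k"

lemma matrix_power_add: "matrix_power A (j + k) = matrix_power A j ** matrix_power A k"
  by (induction j) (simp_all add: matrix_mul_assoc)

lemma matrix_power_Suc_right: "matrix_power A (Suc k) = matrix_power A k ** A"
  using matrix_power_add[of A k 1] by simp

lemma transpose_matrix_power: "transpose (matrix_power A k) = matrix_power (transpose A) k"
  for A :: "'a::comm_semiring_1^'n^'n"
  by (induction k) (simp_all only: matrix_power.simps matrix_transpose_mul transpose_mat
      flip: matrix_power_Suc_right)

lemma matrix_diff_ldistrib: "A ** (B - C) = A ** B - A ** C"
  for A :: "'a::ring_1^'m^'k"
  by (simp add: vec_eq_iff matrix_matrix_mult_def right_diff_distrib sum_subtractf)

lemma matrix_diff_rdistrib: "(A - B) ** C = A ** C - B ** C"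
  for C :: "'a::ring_1^'n^'m"
  by (simp add: vec_eq_iff matrix_matrix_mult_def left_diff_distrib sum_subtractf)

lemma matrix_power_diff:
  fixes X Y :: "'a::ring_1^'n^'n"
  shows "matrix_power X m - matrix_power Y m =
    (\<Sum>q<m. matrix_power X q ** (X - Y) ** matrix_power Y (m - Suc q))"
proof -
  let ?c = "\<lambda>q. matrix_power X q ** matrix_power Y (m - q)"
  have "matrix_power X q ** (X - Y) ** matrix_power Y (m - Suc q) = ?c (Suc q) - ?c q"
    if "q < m" for q
  proof -
    have "matrix_power Y (m - q) = Y ** matrix_power Y (m - Suc q)"
      using that by (simp flip: matrix_power.simps(2) add: Suc_diff_Suc)
    then show ?thesis
      by (simp only: matrix_power_Suc_right matrix_diff_ldistrib matrix_diff_rdistrib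
          matrix_mul_assoc)
  qed
  then have "(\<Sum>q<m. matrix_power X q ** (X - Y) ** matrix_power Y (m - Suc q)) =
      (\<Sum>q<m. ?c (Suc q) - ?c q)"
    by (intro sum.cong) auto
  also have "\<dots> = ?c m - ?c 0"
    by (rule sum_lessThan_telescope)
  finally show ?thesis by simp
qed

text \<open>Equality in Cauchy-Schwarz: at a maximizer \<open>v\<close> of \<open>\<parallel>A v\<parallel>\<close> on the unit sphere, where
  \<open>\<parallel>A v\<parallel>\<close> is the operator norm \<open>r\<close>, both \<open>\<parallel>A (A v)\<parallel> \<le> r\<^sup>2\<close> and \<open>A (A v) \<bullet> v = r\<^sup>2\<close>.\<close>

lemma symmetric_matrix_square_eigenvector:
  fixes A :: "real^'n^'n"
  assumes "transpose A = A"
  obtains v where "norm v = 1" "A *v (A *v v) = (onorm ((*v) A))\<^sup>2 *\<^sub>R v"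
proof -
  define r where "r = onorm ((*v) A)"
  obtain v where unit: "norm v = 1" and attained: "norm (A *v v) = r"
    unfolding r_def using onorm_attained[OF matrix_vector_mul_linear] by blast
  let ?w = "A *v (A *v v)"
  have "norm ?w \<le> r * norm (A *v v)"
    unfolding r_def by (intro onorm matrix_vector_mul_bounded_linear)
  then have w_le: "(norm ?w)\<^sup>2 \<le> (r\<^sup>2)\<^sup>2"
    by (intro power_mono) (simp_all add: attained power2_eq_square)
  have "?w \<bullet> v = (norm (A *v v))\<^sup>2"
    using dot_lmul_matrix[of "A *v v" A v] assms
    by (metis power2_norm_eq_inner transpose_matrix_vector)
  then have w_inner: "?w \<bullet> v = r\<^sup>2"
    by (simp add: attained)
  have "(norm (?w - r\<^sup>2 *\<^sub>R v))\<^sup>2 = (norm ?w)\<^sup>2 - 2 * r\<^sup>2 * (?w \<bullet> v) + (r\<^sup>2)\<^sup>2"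
    using unit by (simp add: power2_norm_eq_inner inner_diff inner_commute norm_eq_1
        power2_eq_square[of "r\<^sup>2"])
  also have "\<dots> = (norm ?w)\<^sup>2 - (r\<^sup>2)\<^sup>2"
    unfolding w_inner by (simp add: power2_eq_square)
  finally have "(norm (?w - r\<^sup>2 *\<^sub>R v))\<^sup>2 \<le> 0"
    using w_le by simp
  then show ?thesis
    using that[OF unit] by (simp add: r_def)
qed

lemma onorm_power_le_norm_matrix_power:
  fixes A :: "real^'n^'n"
  assumes sym: "transpose A = A"
  shows "onorm ((*v) A) ^ n \<le> norm (matrix_power A n)"
proof -
  define r where "r = onorm ((*v) A)"
  obtain v where unit: "norm v = 1" and eigen: "A *v (A *v v) = r\<^sup>2 *\<^sub>R v"
    unfolding r_def by (rule symmetric_matrix_square_eigenvector[OF sym])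
  have even_power: "matrix_power A (2 * n) *v v = (r ^ n)\<^sup>2 *\<^sub>R v"
  proof (induction n)
    case (Suc n)
    then show ?case
      by (simp add: eigen matrix_vector_mult_scaleR power_mult_distrib
          flip: matrix_vector_mul_assoc)
  qed simp
  let ?P = "matrix_power A n"
  have "(r ^ n)\<^sup>2 = v \<bullet> (matrix_power A (2 * n) *v v)"
    using unit by (simp add: even_power norm_eq_1)
  also have "\<dots> = v \<bullet> (transpose ?P *v (?P *v v))"
    by (simp only: mult_2 matrix_power_add matrix_vector_mul_assoc transpose_matrix_power sym)
  also have "\<dots> = (norm (?P *v v))\<^sup>2"
    using dot_lmul_matrix[of "?P *v v" ?P v] by (simp add: power2_norm_eq_inner inner_commute)
  finally have "r ^ n \<le> norm (?P *v v)"
    by (intro power2_le_imp_le[of "r ^ n"]) simp_all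
  also have "\<dots> \<le> norm ?P"
    using norm_matrix_vector_mult_le[of ?P v] unit by simp
  finally show ?thesis by (simp only: r_def)
qed

lemma norm_matrix_power_Suc_squared:
  fixes A :: "real^'n^'n"
  assumes "transpose A = A"
  shows "(norm (matrix_power A (Suc n)))\<^sup>2 = A \<bullet> matrix_power A (2 * n + 1)"
proof -
  have "(norm (matrix_power A (Suc n)))\<^sup>2 = (A ** matrix_power A n) \<bullet> matrix_power A (Suc n)"
    by (simp add: power2_norm_eq_inner)
  also have "\<dots> = A \<bullet> (matrix_power A (Suc n) ** matrix_power A n)"
    by (simp only: inner_matrix_mult_right transpose_matrix_power assms)
  also have "\<dots> = A \<bullet> matrix_power A (2 * n + 1)"
    by (simp add: mult_2 flip: matrix_power_add matrix_power.simps(2))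
  finally show ?thesis .
qed

lemma inner_matrix_power_sandwich:
  fixes X Y D :: "real^'n^'n"
  assumes "transpose X = X" "transpose Y = Y"
  shows "(matrix_power X c ** D ** matrix_power Y e) \<bullet>
      (matrix_power X c' ** D ** matrix_power Y e') =
    D \<bullet> (matrix_power X (c + c') ** D ** matrix_power Y (e' + e))"
  unfolding inner_matrix_mult_right[of _ "matrix_power Y e"]
    inner_matrix_mult_left[of "matrix_power X c"]
  by (simp add: transpose_matrix_power assms matrix_power_add matrix_mul_assoc)

lemma midpoint_convex_le_endpoints:
  fixes w :: "nat \<Rightarrow> real"
  assumes midpoint: "\<And>c d. c \<le> n \<Longrightarrow> d \<le> n \<Longrightarrow> 2 * w (c + d) \<le> w (2 * c) + w (2 * d)"
    and "q \<le> 2 * n"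
  shows "w q \<le> max (w 0) (w (2 * n))"
proof -
  obtain p where "p \<le> 2 * n" and p_max: "\<And>q. q \<le> 2 * n \<Longrightarrow> w q \<le> w p"
    using Max_in[of "w ` {..2 * n}"] Max_ge[of "w ` {..2 * n}"] by fastforce
  have "w p \<le> max (w 0) (w (2 * n))"
  proof (cases "p \<le> n")
    case True
    with midpoint[of 0 p] p_max[of "2 * p"] show ?thesis by simp
  next
    case False
    then have "n + (p - n) = p" "p - n \<le> n"
      using \<open>p \<le> 2 * n\<close> by auto
    with midpoint[of n "p - n"] p_max[of "2 * (p - n)"] show ?thesis by simp
  qed
  with p_max[OF \<open>q \<le> 2 * n\<close>] show ?thesis by (rule order_trans)
qed

text \<open>The midpoint convexity of the left-hand side in \<open>q\<close>, an instance of the inequality between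
  arithmetic and geometric means, replaces the spectral theorem of the usual proof.\<close>

lemma inner_matrix_power_sandwich_le:
  fixes X Y D :: "real^'n^'n"
  assumes sym: "transpose X = X" "transpose Y = Y" and "q \<le> 2 * n"
  shows "D \<bullet> (matrix_power X q ** D ** matrix_power Y (2 * n - q)) \<le>
    (onorm ((*v) D))\<^sup>2 * ((norm (matrix_power X n))\<^sup>2 + (norm (matrix_power Y n))\<^sup>2)"
proof -
  define w where "w q = D \<bullet> (matrix_power X q ** D ** matrix_power Y (2 * n - q))" for q
  define W where "W c = matrix_power X c ** D ** matrix_power Y (n - c)" for c
  have W_inner: "W c \<bullet> W d = w (c + d)" if "c \<le> n" "d \<le> n" for c d
  proof -
    have "n - d + (n - c) = 2 * n - (c + d)"
      using that by simp
    then show ?thesis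
      by (simp only: W_def w_def inner_matrix_power_sandwich[OF sym])
  qed
  have w_even: "w (2 * c) = (norm (W c))\<^sup>2" if "c \<le> n" for c
    using W_inner[OF that that] by (simp add: power2_norm_eq_inner mult_2)
  have "2 * w (c + d) \<le> w (2 * c) + w (2 * d)" if "c \<le> n" "d \<le> n" for c d
    using inner_ge_zero[of "W c - W d"] that
    by (simp add: w_even W_inner inner_diff inner_commute power2_norm_eq_inner)
  then have "w q \<le> max (w 0) (w (2 * n))"
    using \<open>q \<le> 2 * n\<close> by (rule midpoint_convex_le_endpoints)
  moreover have "w 0 \<ge> 0" "w (2 * n) \<ge> 0"
    using w_even[of 0] w_even[of n] by simp_all
  ultimately have "w q \<le> w 0 + w (2 * n)"
    by linarith
  also have "w 0 \<le> (onorm ((*v) D) * norm (matrix_power Y n))\<^sup>2"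
    using w_even[of 0] by (simp add: W_def power_mono norm_matrix_mult_le_onorm_norm)
  also have "w (2 * n) \<le> (norm (matrix_power X n) * onorm ((*v) D))\<^sup>2"
    using w_even[of n] by (simp add: W_def power_mono norm_matrix_mult_le_norm_onorm)
  finally show ?thesis
    by (simp add: w_def algebra_simps)
qed

lemma inner_matrix_power_diff_le:
  fixes X Y :: "real^'n^'n"
  assumes sym: "transpose X = X" "transpose Y = Y"
  shows "(X - Y) \<bullet> (matrix_power X (2 * n + 1) - matrix_power Y (2 * n + 1)) \<le>
    (2 * real n + 1) * (onorm ((*v) (X - Y)))\<^sup>2 *
      ((norm (matrix_power X n))\<^sup>2 + (norm (matrix_power Y n))\<^sup>2)" (is "_ \<le> _ * ?r\<^sup>2 * ?m")
proof -
  have "(X - Y) \<bullet> (matrix_power X (2 * n + 1) - matrix_power Y (2 * n + 1)) =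
      (\<Sum>q<2 * n + 1. (X - Y) \<bullet> (matrix_power X q ** (X - Y) ** matrix_power Y (2 * n - q)))"
    unfolding matrix_power_diff inner_sum_right by simp
  also have "\<dots> \<le> (\<Sum>q<2 * n + 1. ?r\<^sup>2 * ?m)"
    by (intro sum_mono inner_matrix_power_sandwich_le sym) auto
  finally show ?thesis by (simp add: algebra_simps)
qed

subsection \<open>Sampling without replacement\<close>

abbreviation subsets_of_card :: "'i set \<Rightarrow> nat \<Rightarrow> 'i set set" where
  "subsets_of_card A b \<equiv> {S. S \<subseteq> A \<and> card S = b}"

lemma subsets_of_card_nonempty: "b \<le> card A \<Longrightarrow> subsets_of_card A b \<noteq> {}"
  by (drule ex_card) blast

lemma expectation_subsets_of_card:
  fixes f :: "'i set \<Rightarrow> real"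
  assumes "finite A" "b \<le> card A"
  shows "measure_pmf.expectation (pmf_of_set (subsets_of_card A b)) f =
    (\<Sum>S\<in>subsets_of_card A b. f S) / real (card A choose b)"
  using assms by (subst integral_pmf_of_set[OF subsets_of_card_nonempty]) (simp_all add: n_subsets)

lemma card_exchange: "finite S \<Longrightarrow> i \<in> S \<Longrightarrow> j \<notin> S \<Longrightarrow> card (insert j (S - {i})) = card S"
  by (metis Diff_iff card_insert_disjoint card_Suc_Diff1 finite_Diff)

lemma sum_subsets_exchange:
  fixes h :: "'i set \<Rightarrow> 'i \<Rightarrow> 'i \<Rightarrow> 'a::comm_monoid_add"
  assumes "finite A"
  shows "(\<Sum>S\<in>subsets_of_card A b. \<Sum>i\<in>S. \<Sum>j\<in>A - S. h S i j) =
    (\<Sum>S\<in>subsets_of_card A b. \<Sum>i\<in>S. \<Sum>j\<in>A - S. h (insert j (S - {i})) j i)"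
proof -
  define T where "T = (SIGMA S:subsets_of_card A b. S \<times> (A - S))"
  have T_iff: "(S, i, j) \<in> T \<longleftrightarrow> S \<subseteq> A \<and> card S = b \<and> i \<in> S \<and> j \<in> A - S" for S i j
    by (auto simp: T_def)
  have finite_subset_A: "finite S" if "S \<subseteq> A" for S
    using that assms by (rule finite_subset)
  have flat: "(\<Sum>S\<in>subsets_of_card A b. \<Sum>i\<in>S. \<Sum>j\<in>A - S. k S i j) = (\<Sum>(S, i, j)\<in>T. k S i j)"
    for k :: "'i set \<Rightarrow> 'i \<Rightarrow> 'i \<Rightarrow> 'a"
  proof -
    have "(\<Sum>S\<in>subsets_of_card A b. \<Sum>i\<in>S. \<Sum>j\<in>A - S. k S i j) =
        (\<Sum>S\<in>subsets_of_card A b. \<Sum>(i, j)\<in>S \<times> (A - S). k S i j)"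
      by (intro sum.cong refl sum.cartesian_product)
    also have "\<dots> = (\<Sum>(S, i, j)\<in>T. k S i j)"
      unfolding T_def by (rule sum.Sigma) (use assms finite_subset_A in auto)
    finally show ?thesis .
  qed
  let ?swap = "\<lambda>(S, i, j). (insert j (S - {i}), j, i)"
  have swap: "?swap t \<in> T" "?swap (?swap t) = t" if "t \<in> T" for t
  proof -
    obtain S i j where "t = (S, i, j)" by (rule prod_cases3)
    then show "?swap t \<in> T" "?swap (?swap t) = t"
      using that finite_subset_A[of S] card_exchange[of S i j]
      by (auto simp: T_iff)
  qed
  have "(\<Sum>(S, i, j)\<in>T. h S i j) = (\<Sum>(S, i, j)\<in>T. h (insert j (S - {i})) j i)"
    by (rule sum.reindex_bij_witness[where i = ?swap and j = ?swap])
      (simp_all only: swap, auto simp: T_iff insert_absorb)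
  then show ?thesis
    by (simp only: flat)
qed

lemma sum_subsets_pairs_const:
  fixes m :: "'i set \<Rightarrow> real"
  assumes "finite A" "b \<le> card A"
  shows "(\<Sum>S\<in>subsets_of_card A b. \<Sum>i\<in>S. \<Sum>j\<in>A - S. m S) =
    real b * (real (card A) - real b) * (\<Sum>S\<in>subsets_of_card A b. m S)"
  unfolding sum_distrib_left using assms
  by (intro sum.cong) (auto simp: card_Diff_subset finite_subset)

definition sample_mean_error :: "('i \<Rightarrow> 'a::real_vector) \<Rightarrow> 'i set \<Rightarrow> 'i set \<Rightarrow> 'a" where
  "sample_mean_error a A S =
    (1 / real (card S)) *\<^sub>R (\<Sum>i\<in>S. a i) - (1 / real (card A)) *\<^sub>R (\<Sum>i\<in>A. a i)"

lemma linear_sample_mean_error: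
  fixes L :: "'a::real_vector \<Rightarrow> 'b::real_vector"
  assumes "linear L"
  shows "L (sample_mean_error a A S) = sample_mean_error (\<lambda>i. L (a i)) A S"
  by (simp add: sample_mean_error_def linear_diff[OF assms] linear_scale[OF assms]
      linear_sum[OF assms])

lemma transpose_sample_mean_error:
  fixes a :: "'i \<Rightarrow> real^'n^'n"
  assumes "\<And>i. i \<in> A \<Longrightarrow> transpose (a i) = a i" "S \<subseteq> A"
  shows "transpose (sample_mean_error a A S) = sample_mean_error a A S"
proof -
  have "transpose (sample_mean_error a A S) = sample_mean_error (\<lambda>i. transpose (a i)) A S"
    by (rule linear_sample_mean_error[OF linear_transpose])
  also have "\<dots> = sample_mean_error a A S"
    unfolding sample_mean_error_def using assms
    by (intro arg_cong2[where f = minus] arg_cong2[where f = scaleR] sum.cong refl) auto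
  finally show ?thesis .
qed

lemma sample_mean_error_diff_exchange:
  fixes a :: "'i \<Rightarrow> 'a::real_vector"
  assumes "finite S" "i \<in> S" "j \<notin> S"
  shows "sample_mean_error a A S - sample_mean_error a A (insert j (S - {i})) =
    (1 / real (card S)) *\<^sub>R (a i - a j)"
proof -
  have "(\<Sum>k\<in>insert j (S - {i}). a k) = (\<Sum>k\<in>S. a k) - (a i - a j)"
    using assms by (simp add: sum_diff1)
  then show ?thesis
    unfolding sample_mean_error_def card_exchange[OF assms]
    by (simp only:) (simp add: scaleR_diff_right)
qed

lemma sum_differences_eq_sample_mean_error:
  fixes a :: "'i \<Rightarrow> 'a::real_vector"
  assumes "finite A" "S \<subseteq> A" "card S > 0"
  shows "(\<Sum>i\<in>S. \<Sum>j\<in>A - S. a i - a j) =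
    (real (card S) * real (card A)) *\<^sub>R sample_mean_error a A S"
proof -
  have "finite S" using assms(3) by (rule card_ge_0_finite)
  have "card A > 0"
    using assms card_mono[of A S] by linarith
  have "(\<Sum>i\<in>S. \<Sum>j\<in>A - S. a i - a j) =
      real (card (A - S)) *\<^sub>R (\<Sum>i\<in>S. a i) - real (card S) *\<^sub>R (\<Sum>j\<in>A - S. a j)"
    by (simp add: sum_subtractf scaleR_sum_right sum_constant_scaleR)
  also have "real (card (A - S)) = real (card A) - real (card S)"
    using \<open>finite S\<close> assms by (simp add: card_Diff_subset card_mono)
  also have "(\<Sum>j\<in>A - S. a j) = (\<Sum>i\<in>A. a i) - (\<Sum>i\<in>S. a i)"
    using assms by (simp add: sum_diff)
  finally show ?thesis
    using \<open>card S > 0\<close> \<open>card A > 0\<close> by (simp add: sample_mean_error_def algebra_simps)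
qed

lemma sum_inner_sample_mean_error_exchange:
  fixes a :: "'i \<Rightarrow> 'a::real_inner"
  assumes "finite A" "b > 0"
  shows "2 * (real b * real (card A)) * (\<Sum>S\<in>subsets_of_card A b. sample_mean_error a A S \<bullet> P S) =
    (\<Sum>S\<in>subsets_of_card A b. \<Sum>i\<in>S. \<Sum>j\<in>A - S. (a i - a j) \<bullet> (P S - P (insert j (S - {i}))))"
proof -
  let ?tot = "\<lambda>h :: 'i set \<Rightarrow> 'i \<Rightarrow> 'i \<Rightarrow> real. \<Sum>S\<in>subsets_of_card A b. \<Sum>i\<in>S. \<Sum>j\<in>A - S. h S i j"
  have "(real b * real (card A)) * (sample_mean_error a A S \<bullet> P S) =
      (\<Sum>i\<in>S. \<Sum>j\<in>A - S. (a i - a j) \<bullet> P S)" if "S \<in> subsets_of_card A b" for S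
    using sum_differences_eq_sample_mean_error[OF \<open>finite A\<close>, of S a] that \<open>b > 0\<close>
    by (simp flip: inner_sum_left inner_scaleR_left)
  then have sum_eq: "(real b * real (card A)) *
      (\<Sum>S\<in>subsets_of_card A b. sample_mean_error a A S \<bullet> P S) = ?tot (\<lambda>S i j. (a i - a j) \<bullet> P S)"
    by (simp add: sum_distrib_left)
  also have "\<dots> = - ?tot (\<lambda>S i j. (a i - a j) \<bullet> P (insert j (S - {i})))"
    by (subst sum_subsets_exchange[OF \<open>finite A\<close>])
      (simp add: inner_diff_left flip: sum_negf)
  finally show ?thesis
    using sum_eq by (simp add: inner_diff_right sum_subtractf)
qed

subsection \<open>Even moments and tails of the sample mean error\<close>

text \<open>For a symmetric matrix \<open>X\<close>, the squared Frobenius norm of \<open>X\<^sup>n\<close> is the trace of \<open>X\<^bsup>2n\<^esup>\<close>.\<close>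

definition sample_trace_moment :: "('i \<Rightarrow> real^'n^'n) \<Rightarrow> 'i set \<Rightarrow> nat \<Rightarrow> nat \<Rightarrow> real" where
  "sample_trace_moment a A b n = measure_pmf.expectation (pmf_of_set (subsets_of_card A b))
    (\<lambda>S. (norm (matrix_power (sample_mean_error a A S) n))\<^sup>2)"

definition gaussian_even_moment :: "real \<Rightarrow> nat \<Rightarrow> real" where
  "gaussian_even_moment V n = fact (2 * n) / (2 ^ n * fact n) * V ^ n"

lemma gaussian_even_moment_Suc:
  "gaussian_even_moment V (Suc n) = (2 * real n + 1) * V * gaussian_even_moment V n"
  by (simp add: gaussian_even_moment_def divide_simps)

context
  fixes a :: "'i \<Rightarrow> real^'n^'n" and A :: "'i set" and b :: nat and R :: real
  assumes finite_A: "finite A" and b_pos: "0 < b" and b_le: "b \<le> card A"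
    and symmetric: "\<And>i. i \<in> A \<Longrightarrow> transpose (a i) = a i"
    and diameter: "\<And>i j. i \<in> A \<Longrightarrow> j \<in> A \<Longrightarrow> onorm ((*v) (a i - a j)) \<le> R"
begin

lemma inner_sample_exchange_le:
  fixes n :: nat
  assumes "S \<in> subsets_of_card A b" "i \<in> S" "j \<in> A - S"
  defines "X \<equiv> sample_mean_error a A" and "S' \<equiv> insert j (S - {i})"
  shows "(a i - a j) \<bullet> (matrix_power (X S) (2 * n + 1) - matrix_power (X S') (2 * n + 1)) \<le>
    (2 * real n + 1) * (R\<^sup>2 / real b) *
      ((norm (matrix_power (X S) n))\<^sup>2 + (norm (matrix_power (X S') n))\<^sup>2)"
    (is "_ \<bullet> ?P \<le> _ * ?m")
proof -
  have subset: "finite S" "S \<subseteq> A" "S' \<subseteq> A"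
    using assms finite_A by (auto intro: finite_subset)
  have exchange_diff: "X S - X S' = (1 / real b) *\<^sub>R (a i - a j)"
    using sample_mean_error_diff_exchange[of S i j a A] assms subset by (simp add: X_def S'_def)
  have "onorm ((*v) (X S - X S')) = onorm ((*v) (a i - a j)) / real b"
    by (simp add: exchange_diff onorm_scaleR_matrix)
  also have "\<dots> \<le> R / real b"
    using assms subset(2) by (intro divide_right_mono diameter) auto
  finally have "(onorm ((*v) (X S - X S')))\<^sup>2 \<le> (R / real b)\<^sup>2"
    by (intro power_mono) (simp_all add: onorm_pos_le)
  then have "(2 * real n + 1) * (onorm ((*v) (X S - X S')))\<^sup>2 * ?m \<le>
      (2 * real n + 1) * (R / real b)\<^sup>2 * ?m"
    by (intro mult_left_mono mult_right_mono) auto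
  moreover have "(X S - X S') \<bullet> ?P \<le> (2 * real n + 1) * (onorm ((*v) (X S - X S')))\<^sup>2 * ?m"
    unfolding X_def using subset
    by (intro inner_matrix_power_diff_le transpose_sample_mean_error symmetric) auto
  ultimately have "(1 / real b) * ((a i - a j) \<bullet> ?P) \<le> (2 * real n + 1) * (R / real b)\<^sup>2 * ?m"
    unfolding exchange_diff inner_scaleR_left by linarith
  then show ?thesis
    using b_pos by (simp add: field_simps power2_eq_square)
qed

lemma sum_norm_matrix_power_Suc_le:
  fixes n :: nat
  defines "m \<equiv> \<lambda>n S. (norm (matrix_power (sample_mean_error a A S) n))\<^sup>2"
  shows "real (card A) * (\<Sum>S\<in>subsets_of_card A b. m (Suc n) S) \<le>
    (real (card A) - real b) * ((2 * real n + 1) * (R\<^sup>2 / real b)) *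
      (\<Sum>S\<in>subsets_of_card A b. m n S)"
proof -
  define P where "P S = matrix_power (sample_mean_error a A S) (2 * n + 1)" for S
  define k where "k = (2 * real n + 1) * (R\<^sup>2 / real b)"
  let ?C = "subsets_of_card A b"
  have "m (Suc n) S = sample_mean_error a A S \<bullet> P S" if "S \<in> ?C" for S
    unfolding m_def P_def using that
    by (intro norm_matrix_power_Suc_squared transpose_sample_mean_error symmetric) auto
  then have "2 * (real b * real (card A)) * (\<Sum>S\<in>?C. m (Suc n) S) =
      (\<Sum>S\<in>?C. \<Sum>i\<in>S. \<Sum>j\<in>A - S. (a i - a j) \<bullet> (P S - P (insert j (S - {i}))))"
    using sum_inner_sample_mean_error_exchange[OF finite_A b_pos, of a P] by simp
  also have "\<dots> \<le> (\<Sum>S\<in>?C. \<Sum>i\<in>S. \<Sum>j\<in>A - S. k * (m n S + m n (insert j (S - {i}))))"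
    unfolding k_def m_def P_def by (intro sum_mono inner_sample_exchange_le)
  also have "\<dots> = 2 * (\<Sum>S\<in>?C. \<Sum>i\<in>S. \<Sum>j\<in>A - S. k * m n S)"
    using sum_subsets_exchange[OF finite_A, of "\<lambda>S i j. k * m n S" b]
    by (simp add: distrib_left sum.distrib)
  also have "\<dots> = 2 * (real b * (real (card A) - real b) * (k * (\<Sum>S\<in>?C. m n S)))"
    by (simp only: sum_subsets_pairs_const[OF finite_A b_le] sum_distrib_left)
  finally have "(2 * real b) * (real (card A) * (\<Sum>S\<in>?C. m (Suc n) S)) \<le>
      (2 * real b) * ((real (card A) - real b) * k * (\<Sum>S\<in>?C. m n S))"
    by (simp only: mult.assoc)
  then have "real (card A) * (\<Sum>S\<in>?C. m (Suc n) S) \<le>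
      (real (card A) - real b) * k * (\<Sum>S\<in>?C. m n S)"
    using b_pos by simp
  then show ?thesis by (simp only: k_def)
qed

lemma sample_trace_moment_Suc_le:
  "sample_trace_moment a A b (Suc n) \<le>
    (2 * real n + 1) * (R\<^sup>2 * (1 / real b - 1 / real (card A))) * sample_trace_moment a A b n"
proof -
  let ?T = "\<lambda>n. \<Sum>S\<in>subsets_of_card A b. (norm (matrix_power (sample_mean_error a A S) n))\<^sup>2"
  let ?N = "real (card A)"
  have "?N > 0" using b_pos b_le by simp
  have "?T (Suc n) \<le> (?N - real b) * ((2 * real n + 1) * (R\<^sup>2 / real b)) * ?T n / ?N"
    using sum_norm_matrix_power_Suc_le[of n] \<open>?N > 0\<close> by (simp only: pos_le_divide_eq mult_ac)
  also have "\<dots> = (2 * real n + 1) * (R\<^sup>2 * (1 / real b - 1 / ?N)) * ?T n"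
    using b_pos b_le by (simp add: field_simps)
  finally have "?T (Suc n) / real (card A choose b) \<le>
      (2 * real n + 1) * (R\<^sup>2 * (1 / real b - 1 / ?N)) * ?T n / real (card A choose b)"
    by (rule divide_right_mono) simp
  then show ?thesis
    by (simp only: sample_trace_moment_def expectation_subsets_of_card[OF finite_A b_le]
        times_divide_eq_right)
qed

lemma sample_trace_moment_le:
  "sample_trace_moment a A b n \<le>
    real CARD('n) * gaussian_even_moment (R\<^sup>2 * (1 / real b - 1 / real (card A))) n"
proof (induction n)
  case 0
  show ?case by (simp add: sample_trace_moment_def gaussian_even_moment_def norm_mat_1_squared)
next
  case (Suc n)
  define V where "V = R\<^sup>2 * (1 / real b - 1 / real (card A))"
  have "V \<ge> 0" using b_pos b_le by (simp add: V_def frac_le)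
  have "sample_trace_moment a A b (Suc n) \<le> (2 * real n + 1) * V * sample_trace_moment a A b n"
    unfolding V_def by (rule sample_trace_moment_Suc_le)
  also have "\<dots> \<le> (2 * real n + 1) * V * (real CARD('n) * gaussian_even_moment V n)"
    using Suc.IH \<open>V \<ge> 0\<close> by (intro mult_left_mono) (simp_all add: V_def)
  also have "\<dots> = real CARD('n) * gaussian_even_moment V (Suc n)"
    by (simp add: gaussian_even_moment_Suc)
  finally show ?case by (simp only: V_def)
qed

lemma prob_onorm_sample_mean_error_power_le:
  assumes "t \<ge> 0"
  shows "measure_pmf.prob (pmf_of_set (subsets_of_card A b))
      {S. t \<le> onorm ((*v) (sample_mean_error a A S))} * t ^ (2 * n) \<le> sample_trace_moment a A b n"
    (is "measure_pmf.prob ?p ?B * _ \<le> _")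
proof -
  let ?X = "sample_mean_error a A"
  have set_p: "set_pmf ?p = subsets_of_card A b"
    using finite_A b_le by (intro set_pmf_of_set subsets_of_card_nonempty) simp_all
  have "t ^ (2 * n) \<le> (norm (matrix_power (?X S) n))\<^sup>2"
    if "S \<in> subsets_of_card A b" "t \<le> onorm ((*v) (?X S))" for S
  proof -
    have "t ^ n \<le> onorm ((*v) (?X S)) ^ n"
      using that(2) \<open>t \<ge> 0\<close> by (rule power_mono)
    also have "\<dots> \<le> norm (matrix_power (?X S) n)"
      using that(1)
      by (intro onorm_power_le_norm_matrix_power transpose_sample_mean_error symmetric) auto
    finally show ?thesis
      using \<open>t \<ge> 0\<close> by (simp add: power_mono power_mult mult.commute[of 2 n])
  qed
  then have "measure_pmf.expectation ?p (\<lambda>S. indicator ?B S * t ^ (2 * n)) \<le>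
      sample_trace_moment a A b n"
    unfolding sample_trace_moment_def
    by (intro integral_mono_AE integrable_measure_pmf_finite)
      (simp_all add: set_p finite_A AE_measure_pmf_iff indicator_def)
  then show ?thesis by simp
qed

end

lemma cosh_sums_even: "(\<lambda>n. x ^ (2 * n) / fact (2 * n)) sums cosh (x :: real)"
proof -
  let ?f = "\<lambda>n. if even n then x ^ n /\<^sub>R fact n else 0"
  have "(\<lambda>n. ?f (2 * n)) sums cosh x"
    by (subst sums_mono_reindex[of "\<lambda>n. 2 * n" ?f])
      (auto simp: strict_mono_def cosh_converges elim!: evenE)
  then show ?thesis by (simp add: divide_inverse mult.commute)
qed

text \<open>Summing the moment bounds with weights \<open>\<theta>\<^bsup>2n\<^esup> / (2n)!\<close> gives the Chernoff bound
  \<open>p cosh (\<theta> t) \<le> K E cosh (\<theta> Z)\<close> for a centered Gaussian \<open>Z\<close> of variance \<open>V\<close>, optimized at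
  \<open>\<theta> = t / V\<close>.\<close>

lemma gaussian_tail_of_even_moments:
  fixes p t K V :: real
  assumes "p \<ge> 0" "V > 0" and moment: "\<And>n. p * t ^ (2 * n) \<le> K * gaussian_even_moment V n"
  shows "p \<le> 2 * K * exp (- (t\<^sup>2 / (2 * V)))"
proof -
  define \<theta> where "\<theta> = t / V"
  have term_le: "p * ((\<theta> * t) ^ (2 * n) / fact (2 * n)) \<le> K * ((\<theta>\<^sup>2 * V / 2) ^ n /\<^sub>R fact n)" for n
  proof -
    have "\<theta> ^ (2 * n) / fact (2 * n) * (p * t ^ (2 * n)) \<le>
        \<theta> ^ (2 * n) / fact (2 * n) * (K * gaussian_even_moment V n)"
      by (intro mult_left_mono moment) (simp add: power_mult)
    then show ?thesis
      by (simp add: gaussian_even_moment_def field_simps flip: power_mult)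
  qed
  have "(\<lambda>n. p * ((\<theta> * t) ^ (2 * n) / fact (2 * n))) sums (p * cosh (\<theta> * t))"
    by (intro sums_mult cosh_sums_even)
  moreover have "(\<lambda>n. K * ((\<theta>\<^sup>2 * V / 2) ^ n /\<^sub>R fact n)) sums (K * exp (\<theta>\<^sup>2 * V / 2))"
    by (intro sums_mult exp_converges)
  ultimately have "p * cosh (\<theta> * t) \<le> K * exp (\<theta>\<^sup>2 * V / 2)"
    by (rule sums_le[OF term_le])
  moreover have "p * (exp (\<theta> * t) / 2) \<le> p * cosh (\<theta> * t)"
    using \<open>p \<ge> 0\<close> by (intro mult_left_mono) (simp_all add: cosh_def)
  ultimately have "p \<le> 2 * K * (exp (\<theta>\<^sup>2 * V / 2) / exp (\<theta> * t))"
    by (simp add: field_simps)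
  also have "exp (\<theta>\<^sup>2 * V / 2) / exp (\<theta> * t) = exp (- (t\<^sup>2 / (2 * V)))"
    using \<open>V > 0\<close> by (simp add: \<theta>_def power2_eq_square field_simps flip: exp_diff)
  finally show ?thesis .
qed

lemma prob_onorm_symmetric_sample_mean_error_ge_le:
  fixes a :: "'i \<Rightarrow> real^'n^'n"
  assumes "finite A" "0 < b" "b < card A" "R > 0" "t \<ge> 0"
    and "\<And>i. i \<in> A \<Longrightarrow> transpose (a i) = a i"
    and "\<And>i j. i \<in> A \<Longrightarrow> j \<in> A \<Longrightarrow> onorm ((*v) (a i - a j)) \<le> R"
  shows "measure_pmf.prob (pmf_of_set (subsets_of_card A b))
      {S. t \<le> onorm ((*v) (sample_mean_error a A S))} \<le>
    2 * real CARD('n) * exp (- (t\<^sup>2 / (2 * (R\<^sup>2 * (1 / real b - 1 / real (card A))))))"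
proof (rule gaussian_tail_of_even_moments)
  show "R\<^sup>2 * (1 / real b - 1 / real (card A)) > 0"
    using assms(2-4) by (simp add: field_simps)
  show "measure_pmf.prob (pmf_of_set (subsets_of_card A b))
      {S. t \<le> onorm ((*v) (sample_mean_error a A S))} * t ^ (2 * n) \<le>
    real CARD('n) * gaussian_even_moment (R\<^sup>2 * (1 / real b - 1 / real (card A))) n" for n
    using assms
    by (intro order_trans[OF prob_onorm_sample_mean_error_power_le sample_trace_moment_le]) auto
qed simp

subsection \<open>Hermitian dilation\<close>

definition dilation :: "real^'n^'m \<Rightarrow> real^('m + 'n)^('m + 'n)" where
  "dilation A = (\<chi> i j. case (i, j) of (Inl p, Inr q) \<Rightarrow> A $ p $ q
    | (Inr q, Inl p) \<Rightarrow> A $ p $ q | _ \<Rightarrow> 0)"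

lemma linear_dilation: "linear dilation"
  by (rule linearI) (auto simp: dilation_def vec_eq_iff split: sum.splits)

lemma transpose_dilation: "transpose (dilation A) = dilation A"
  by (auto simp: dilation_def vec_eq_iff transpose_def split: sum.splits)

lemma sum_UNIV_Plus:
  fixes h :: "'m::finite + 'n::finite \<Rightarrow> 'a::comm_monoid_add"
  shows "(\<Sum>i\<in>UNIV. h i) = (\<Sum>p\<in>UNIV. h (Inl p)) + (\<Sum>q\<in>UNIV. h (Inr q))"
  by (subst UNIV_Plus_UNIV[symmetric], subst sum.Plus) simp_all

lemma norm_vec_Plus_squared:
  fixes z :: "real^('m::finite + 'n::finite)"
  shows "(norm z)\<^sup>2 = (norm (\<chi> p. z $ Inl p))\<^sup>2 + (norm (\<chi> q. z $ Inr q))\<^sup>2"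
  by (simp add: power2_norm_eq_inner inner_vec_def sum_UNIV_Plus)

lemma norm_dilation_mult_squared:
  "(norm (dilation A *v z))\<^sup>2 =
    (norm (A *v (\<chi> q. z $ Inr q)))\<^sup>2 + (norm (transpose A *v (\<chi> p. z $ Inl p)))\<^sup>2"
proof -
  have "(\<chi> p. (dilation A *v z) $ Inl p) = A *v (\<chi> q. z $ Inr q)"
    by (simp add: vec_eq_iff matrix_vector_mult_def dilation_def sum_UNIV_Plus)
  moreover have "(\<chi> q. (dilation A *v z) $ Inr q) = transpose A *v (\<chi> p. z $ Inl p)"
    by (simp add: vec_eq_iff matrix_vector_mult_def transpose_def dilation_def sum_UNIV_Plus)
  ultimately show ?thesis
    by (simp add: norm_vec_Plus_squared[of "dilation A *v z"])
qed

lemma onorm_dilation: "onorm ((*v) (dilation A)) = onorm ((*v) A)"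
  for A :: "real^'n^'m"
proof (rule antisym)
  let ?r = "onorm ((*v) A)"
  have "?r \<ge> 0"
    by (intro onorm_pos_le matrix_vector_mul_bounded_linear)
  show "onorm ((*v) (dilation A)) \<le> ?r"
  proof (rule onorm_le, rule power2_le_imp_le)
    fix z
    have "(norm (dilation A *v z))\<^sup>2 \<le>
        (?r * norm (\<chi> q. z $ Inr q))\<^sup>2 + (?r * norm (\<chi> p. z $ Inl p))\<^sup>2"
      unfolding norm_dilation_mult_squared
      by (intro add_mono power_mono norm_ge_zero onorm[OF matrix_vector_mul_bounded_linear]
          onorm[OF matrix_vector_mul_bounded_linear, of "transpose A", unfolded onorm_transpose])
    also have "\<dots> = (?r * norm z)\<^sup>2"
      by (simp add: norm_vec_Plus_squared[of z] power_mult_distrib distrib_left)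
    finally show "(norm (dilation A *v z))\<^sup>2 \<le> (?r * norm z)\<^sup>2" .
  qed (use \<open>?r \<ge> 0\<close> in simp)
  show "?r \<le> onorm ((*v) (dilation A))"
  proof (rule onorm_le)
    fix v
    define z :: "real^('m + 'n)" where "z = (\<chi> i. case i of Inl p \<Rightarrow> 0 | Inr q \<Rightarrow> v $ q)"
    have z_parts: "(\<chi> p. z $ Inl p) = 0" "(\<chi> q. z $ Inr q) = v"
      by (simp_all add: z_def vec_eq_iff)
    have "(norm (dilation A *v z))\<^sup>2 = (norm (A *v v))\<^sup>2"
      by (simp add: norm_dilation_mult_squared z_parts)
    moreover have "(norm z)\<^sup>2 = (norm v)\<^sup>2"
      by (simp add: norm_vec_Plus_squared[of z] z_parts)
    ultimately show "norm (A *v v) \<le> onorm ((*v) (dilation A)) * norm v"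
      using onorm[OF matrix_vector_mul_bounded_linear, of "dilation A" z] by simp
  qed
qed

lemma prob_onorm_sample_mean_error_ge_le:
  fixes a :: "'i \<Rightarrow> real^'n^'m"
  assumes "finite A" "0 < b" "b < card A" "\<sigma> > 0" "t \<ge> 0"
    and bound: "\<And>i. i \<in> A \<Longrightarrow> onorm ((*v) (a i)) \<le> \<sigma>"
  shows "measure_pmf.prob (pmf_of_set (subsets_of_card A b))
      {S. t \<le> onorm ((*v) (sample_mean_error a A S))} \<le>
    2 * (real CARD('m) + real CARD('n)) *
      exp (- (t\<^sup>2 / (8 * \<sigma>\<^sup>2 * (1 / real b - 1 / real (card A)))))"
proof -
  have diameter: "onorm ((*v) (dilation (a i) - dilation (a j))) \<le> 2 * \<sigma>"
    if "i \<in> A" "j \<in> A" for i j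
  proof -
    have "onorm ((*v) (dilation (a i) - dilation (a j))) = onorm ((*v) (a i - a j))"
      by (simp only: linear_diff[OF linear_dilation, symmetric] onorm_dilation)
    also have "\<dots> \<le> onorm ((*v) (a i)) + onorm ((*v) (a j))"
      by (rule onorm_matrix_diff_le)
    finally show ?thesis
      using bound[OF that(1)] bound[OF that(2)] by simp
  qed
  have "onorm ((*v) (sample_mean_error (\<lambda>i. dilation (a i)) A S)) =
      onorm ((*v) (sample_mean_error a A S))" for S
    by (simp only: linear_sample_mean_error[OF linear_dilation, symmetric] onorm_dilation)
  moreover have "2 * ((2 * \<sigma>)\<^sup>2 * c) = 8 * \<sigma>\<^sup>2 * c" for c
    by (simp add: power_mult_distrib)
  ultimately show ?thesis
    using prob_onorm_symmetric_sample_mean_error_ge_le[where a = "\<lambda>i. dilation (a i)",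
        OF assms(1-3) _ assms(5) transpose_dilation diameter] \<open>\<sigma> > 0\<close>
    by (simp add: mult.assoc)
qed

subsection \<open>Concentration of the subsampled estimators\<close>

lemma sample_mean_error_concentration:
  fixes a :: "'i \<Rightarrow> real^'n^'m" and \<sigma> \<epsilon> \<zeta> :: real
  defines "l \<equiv> ln (2 * (real CARD('m) + real CARD('n)) / \<zeta>)"
  assumes "finite A" "0 < b" "b < card A" "\<sigma> > 0" "\<epsilon> \<ge> 0" "\<zeta> > 0"
    and "\<And>i. i \<in> A \<Longrightarrow> onorm ((*v) (a i)) \<le> \<sigma>"
    and size: "8 * \<sigma>\<^sup>2 * (1 / real b - 1 / real (card A)) * l \<le> \<epsilon>\<^sup>2"
  shows "measure_pmf.prob (pmf_of_set (subsets_of_card A b))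
    {S. onorm ((*v) (sample_mean_error a A S)) \<le> \<epsilon>} \<ge> 1 - \<zeta>"
proof -
  define K where "K = 2 * (real CARD('m) + real CARD('n))"
  define V where "V = 8 * \<sigma>\<^sup>2 * (1 / real b - 1 / real (card A))"
  let ?p = "pmf_of_set (subsets_of_card A b)"
  let ?r = "\<lambda>S. onorm ((*v) (sample_mean_error a A S))"
  have "K > 0" by (simp add: K_def add_pos_pos)
  have l_eq: "l = ln (K / \<zeta>)" by (simp only: l_def K_def)
  have "V > 0" using assms by (simp add: V_def field_simps)
  have exponent: "l \<le> \<epsilon>\<^sup>2 / V"
    using size \<open>V > 0\<close> by (simp only: V_def pos_le_divide_eq mult.commute)
  have "measure_pmf.prob ?p {S. \<epsilon> \<le> ?r S} \<le> K * exp (- (\<epsilon>\<^sup>2 / V))"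
    unfolding K_def V_def by (intro prob_onorm_sample_mean_error_ge_le assms)
  also have "\<dots> \<le> K * exp (- l)"
    using \<open>K > 0\<close> exponent by simp
  also have "\<dots> = \<zeta>"
    using \<open>K > 0\<close> \<open>\<zeta> > 0\<close> by (simp add: l_eq exp_minus)
  finally have "measure_pmf.prob ?p {S. \<epsilon> \<le> ?r S} \<le> \<zeta>" .
  moreover have "measure_pmf.prob ?p {S. \<not> ?r S \<le> \<epsilon>} \<le> measure_pmf.prob ?p {S. \<epsilon> \<le> ?r S}"
    by (rule measure_pmf.finite_measure_mono) auto
  moreover have "measure_pmf.prob ?p {S. \<not> ?r S \<le> \<epsilon>} = 1 - measure_pmf.prob ?p {S. ?r S \<le> \<epsilon>}"
    by (rule measure_pmf.prob_neg[where M = ?p, simplified])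
  ultimately show ?thesis by linarith
qed

text \<open>Division by zero makes the size condition \<open>b \<ge> N\<close> when \<open>\<sigma> = 0\<close>; for \<open>\<sigma> \<noteq> 0\<close> it leaves a
  factor of 8 to spare.\<close>

lemma sample_size_sufficient:
  fixes \<sigma> \<epsilon> l :: real
  assumes "b < N" "l > 0"
    and size: "inverse (1 / real N + \<epsilon>\<^sup>2 / (64 * \<sigma>\<^sup>2 * l)) \<le> real b"
  shows "0 < b" "\<sigma> \<noteq> 0" "8 * \<sigma>\<^sup>2 * (1 / real b - 1 / real N) * l \<le> \<epsilon>\<^sup>2"
proof -
  define q where "q = 1 / real N + \<epsilon>\<^sup>2 / (64 * \<sigma>\<^sup>2 * l)"
  have "q > 0" using assms by (simp add: q_def add_pos_nonneg)
  with size show "0 < b"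
    by (metis q_def inverse_positive_iff_positive less_le_trans of_nat_0_less_iff)
  moreover have "inverse q \<le> real b"
    using size by (simp only: q_def)
  ultimately have q_ge: "1 / real b \<le> q"
    using \<open>q > 0\<close> by (simp add: field_simps)
  show "\<sigma> \<noteq> 0"
  proof
    assume "\<sigma> = 0"
    with q_ge \<open>0 < b\<close> \<open>b < N\<close> show False by (simp add: q_def field_simps)
  qed
  then have "64 * \<sigma>\<^sup>2 * l > 0"
    using \<open>l > 0\<close> by simp
  define d where "d = 1 / real b - 1 / real N"
  have "d \<ge> 0"
    using \<open>0 < b\<close> \<open>b < N\<close> by (simp add: d_def frac_le)
  have "d \<le> \<epsilon>\<^sup>2 / (64 * \<sigma>\<^sup>2 * l)"
    using q_ge by (simp add: d_def q_def)
  then have "64 * (\<sigma>\<^sup>2 * d * l) \<le> \<epsilon>\<^sup>2"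
    using \<open>64 * \<sigma>\<^sup>2 * l > 0\<close> by (simp only: pos_le_divide_eq mult_ac)
  moreover have "\<sigma>\<^sup>2 * d * l \<ge> 0"
    using \<open>d \<ge> 0\<close> \<open>l > 0\<close> by simp
  ultimately show "8 * \<sigma>\<^sup>2 * (1 / real b - 1 / real N) * l \<le> \<epsilon>\<^sup>2"
    by (simp add: d_def[symmetric])
qed

lemma vr_est_error_eq_sample_mean_error:
  "vr_est h S x xt (avg_vec N h xt) - avg_vec N h x =
    sample_mean_error (\<lambda>i. h i x - h i xt) {0..<N} S"
  by (simp add: vr_est_def avg_vec_def sample_mean_error_def sum_subtractf scaleR_diff_right
      lessThan_atLeast0)

lemma vr_est_matrix_concentration:
  fixes h :: "nat \<Rightarrow> 'a \<Rightarrow> real^'n^'m" and \<sigma> \<epsilon> \<zeta> :: real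
  assumes "b < N" "\<epsilon> \<ge> 0" "0 < \<zeta>" "\<zeta> < 1"
    and bound: "\<And>i. i < N \<Longrightarrow> onorm ((*v) (h i x - h i xt)) \<le> \<sigma>"
    and size: "inverse (1 / real N +
      \<epsilon>\<^sup>2 / (64 * \<sigma>\<^sup>2 * ln (2 * (real CARD('m) + real CARD('n)) / \<zeta>))) \<le> real b"
  shows "measure_pmf.prob (subset_sample N b)
    {S. onorm ((*v) (vr_est h S x xt (avg_vec N h xt) - avg_vec N h x)) \<le> \<epsilon>} \<ge> 1 - \<zeta>"
proof -
  have "\<zeta> < 1" by fact
  also have "1 \<le> real CARD('m)" by (simp add: Suc_le_eq)
  also have "\<dots> \<le> 2 * (real CARD('m) + real CARD('n))" by simp
  finally have "ln (2 * (real CARD('m) + real CARD('n)) / \<zeta>) > 0"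
    using \<open>0 < \<zeta>\<close> by (intro ln_gt_zero) (simp add: less_divide_eq)
  note size_facts = sample_size_sufficient[OF \<open>b < N\<close> this size]
  have "\<sigma> \<ge> 0"
    using onorm_pos_le[OF matrix_vector_mul_bounded_linear] bound[of 0] \<open>b < N\<close>
    by (auto intro: order_trans)
  with size_facts(2) have "\<sigma> > 0" by simp
  then show ?thesis
    unfolding vr_est_error_eq_sample_mean_error subset_sample_def
    using assms size_facts by (intro sample_mean_error_concentration) auto
qed

lemma linear_columnvector: "linear (columnvector :: real^'n \<Rightarrow> real^1^'n)"
  by (rule linearI) (simp_all add: columnvector_def vec_eq_iff)

lemma onorm_columnvector: "onorm ((*v) (columnvector y :: real^1^'n)) = norm y"
proof (rule antisym)
  have norm_mult: "norm ((columnvector y :: real^1^'n) *v u) = norm y * norm u" for u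
  proof -
    have "(columnvector y :: real^1^'n) *v u = u $ 1 *\<^sub>R y"
      by (simp add: vec_eq_iff columnvector_def matrix_vector_mult_def sum_1 mult.commute)
    then show ?thesis by (simp add: norm_real)
  qed
  then show "onorm ((*v) (columnvector y :: real^1^'n)) \<le> norm y"
    by (intro onorm_le) simp
  show "norm y \<le> onorm ((*v) (columnvector y :: real^1^'n))"
    using onorm[OF matrix_vector_mul_bounded_linear, of "columnvector y :: real^1^'n" 1]
    by (simp add: norm_mult)
qed

lemma vr_est_vector_concentration:
  fixes h :: "nat \<Rightarrow> 'a \<Rightarrow> real^'n" and \<sigma> \<epsilon> \<zeta> :: real
  assumes "b < N" "\<epsilon> \<ge> 0" "0 < \<zeta>" "\<zeta> < 1"
    and "\<And>i. i < N \<Longrightarrow> norm (h i x - h i xt) \<le> \<sigma>"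
    and "inverse (1 / real N + \<epsilon>\<^sup>2 / (64 * \<sigma>\<^sup>2 * ln (2 * (real CARD('n) + 1) / \<zeta>))) \<le> real b"
  shows "measure_pmf.prob (subset_sample N b)
    {S. norm (vr_est h S x xt (avg_vec N h xt) - avg_vec N h x) \<le> \<epsilon>} \<ge> 1 - \<zeta>"
proof -
  let ?C = "columnvector :: real^'n \<Rightarrow> real^1^'n"
  have diff: "?C (h i x) - ?C (h i xt) = ?C (h i x - h i xt)" for i
    by (rule linear_diff[OF linear_columnvector, symmetric])
  let ?g = "\<lambda>i x. ?C (h i x)"
  have "onorm ((*v) (vr_est ?g S x xt (avg_vec N ?g xt) - avg_vec N ?g x)) =
      norm (vr_est h S x xt (avg_vec N h xt) - avg_vec N h x)" for S
    by (simp only: vr_est_error_eq_sample_mean_error diff onorm_columnvector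
        linear_sample_mean_error[OF linear_columnvector, symmetric])
  with vr_est_matrix_concentration[OF assms(1-4), of ?g x xt \<sigma>] assms(5,6)
  show ?thesis
    by (simp add: diff onorm_columnvector)
qed

lemma max_power_nonneg: "max (x ^ n) (y ^ n) = max x y ^ n" if "0 \<le> x" "0 \<le> y" for x y :: real
  using that by (auto simp: max_def power_mono dest: power_mono[of y x n] intro: antisym)

theorem theorem5:
  fixes f :: "nat \<Rightarrow> real^'n \<Rightarrow> real"
    and gf :: "nat \<Rightarrow> real^'n \<Rightarrow> real^'n"
    and Hf :: "nat \<Rightarrow> real^'n \<Rightarrow> real^'n^'n"
    and N :: nat and L0 L1 L2 \<alpha> \<beta> \<epsilon>1 \<zeta> :: real
    and xk xt sk :: "real^'n"
    and bg bH :: nat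
  assumes N_pos: "N \<ge> 1"
    and grad: "\<And>i x. i < N \<Longrightarrow> (f i has_derivative (\<lambda>h. gf i x \<bullet> h)) (at x)"
    and hess: "\<And>i x. i < N \<Longrightarrow> (gf i has_derivative (\<lambda>h. Hf i x *v h)) (at x)"
    and F_bdd: "bdd_below (range (\<lambda>x. avg_vec N f x))"
    and lip0: "\<And>i x y. i < N \<Longrightarrow> \<bar>f i x - f i y\<bar> \<le> L0 * norm (x - y)"
    and lip1: "\<And>i x y. i < N \<Longrightarrow> norm (gf i x - gf i y) \<le> L1 * norm (x - y)"
    and lip2: "\<And>i x y. i < N \<Longrightarrow> spec_norm (Hf i x - Hf i y) \<le> L2 * norm (x - y)"
    and alpha_pos: "\<alpha> > 0" and beta_pos: "\<beta> > 0" and eps_pos: "\<epsilon>1 > 0"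
    and zeta: "0 < \<zeta>" "\<zeta> < 1"
    and bg_lt: "bg < N" and bH_lt: "bH < N"
  shows
    "(real bg \<ge> inverse (1 / real N + \<beta>^2 * max (norm sk ^ 4) (\<epsilon>1 ^ 4)
          / (64 * L1^2 * (norm (xk - xt))^2 * ln (2 * (real CARD('n) + 1) / \<zeta>)))
      \<longrightarrow> measure_pmf.prob (subset_sample N bg)
            {S. norm (vr_est gf S xk xt (avg_vec N gf xt) - avg_vec N gf xk)
                  \<le> \<beta> * max (norm sk ^ 2) (\<epsilon>1 ^ 2)} \<ge> 1 - \<zeta>)
     \<and>
     (real bH \<ge> inverse (1 / real N + \<alpha>^2 * max (norm sk ^ 2) (\<epsilon>1 ^ 2)
          / (64 * L2^2 * (norm (xk - xt))^2 * ln (4 * real CARD('n) / \<zeta>)))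
      \<longrightarrow> measure_pmf.prob (subset_sample N bH)
            {S. spec_norm (vr_est Hf S xk xt (avg_vec N Hf xt) - avg_vec N Hf xk)
                  \<le> \<alpha> * max (norm sk) \<epsilon>1} \<ge> 1 - \<zeta>)"
proof (intro conjI impI)
  have max_powers: "max (norm sk ^ 2) (\<epsilon>1 ^ 2) = max (norm sk) \<epsilon>1 ^ 2"
      "max (norm sk ^ 4) (\<epsilon>1 ^ 4) = (max (norm sk) \<epsilon>1 ^ 2)\<^sup>2"
    using eps_pos by (simp_all add: max_power_nonneg)
  show "measure_pmf.prob (subset_sample N bg)
      {S. norm (vr_est gf S xk xt (avg_vec N gf xt) - avg_vec N gf xk)
        \<le> \<beta> * max (norm sk ^ 2) (\<epsilon>1 ^ 2)} \<ge> 1 - \<zeta>"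
    if "real bg \<ge> inverse (1 / real N + \<beta>^2 * max (norm sk ^ 4) (\<epsilon>1 ^ 4)
          / (64 * L1^2 * (norm (xk - xt))^2 * ln (2 * (real CARD('n) + 1) / \<zeta>)))"
    using vr_est_vector_concentration[OF bg_lt _ zeta,
        of "\<beta> * max (norm sk) \<epsilon>1 ^ 2" gf xk xt "L1 * norm (xk - xt)"] that lip1 beta_pos
    by (simp add: max_powers power_mult_distrib mult.assoc)
  show "measure_pmf.prob (subset_sample N bH)
      {S. spec_norm (vr_est Hf S xk xt (avg_vec N Hf xt) - avg_vec N Hf xk)
        \<le> \<alpha> * max (norm sk) \<epsilon>1} \<ge> 1 - \<zeta>"
    if "real bH \<ge> inverse (1 / real N + \<alpha>^2 * max (norm sk ^ 2) (\<epsilon>1 ^ 2)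
          / (64 * L2^2 * (norm (xk - xt))^2 * ln (4 * real CARD('n) / \<zeta>)))"
    using vr_est_matrix_concentration[OF bH_lt _ zeta,
        of "\<alpha> * max (norm sk) \<epsilon>1" Hf xk xt "L2 * norm (xk - xt)"] that lip2 alpha_pos eps_pos
    by (simp add: max_powers power_mult_distrib mult.assoc spec_norm_def)
qed

end
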